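(* For $\lambda\in\mathbb{Q}$ put \[ \alpha=\frac{4\lambda}{\lambda^2+3},\qquad \beta=\frac{(1-\lambda)(\lambda+3)}{\lambda^2+3}, \] \[ r=\frac{6\lambda(1-\lambda^2)(9-\lambda^2)}{(\lambda^2+3)^3},\qquad \delta=\frac{(3-\lambda^2)(3+6\lambda-\lambda^2)(3-6\lambda-\lambda^2)}{(\lambda^2+3)^3}, \qquad z_\pm=r\pm\delta, \] \[ \rho_4(\lambda)=\frac{1-r^2}{1+r^2}, \] \[ T_0=\left(2-4r^2,\,2r^2+\delta,\,2r^2-\delta\right),\qquad T_1=\left(\frac23,\,\frac{2+\delta}{3},\,\frac{2-\delta}{3}\right), \] and for $z\in\mathbb{Q}$ let $I(z)=\left(1-z^2,\frac{1+z^2}{2},\frac{1+z^2}{2}\right)$, where triangles are given by their side lengths. Then for every $\lambda\in\mathbb{Q}$ with $\frac13\leq\lambda\leq\frac37$, the value $\rho=\rho_4(\lambda)$ admits at least four distinct genuine pairs, namely \[ \bigl(T_0,I(z_-)\bigr),\qquad\bigl(T_0,I(z_+)\bigr),\qquad\bigl(T_1,I(\alpha)\bigr),\qquad\bigl(T_1,I(\beta)\bigr). \] In particular, there are infinitely many rational values of $\rho$ carrying at least four distinct genuine pairs.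
   Context: A rational triangle is a triangle with rational side lengths (its area need not be rational). For $\rho\in\mathbb{Q}\cap(-1,1)$ let $\theta\in(0,\pi)$ be the angle with $\cos\theta=\rho$. A genuine pair for $\rho$ is a pair $(T,I)$ of non-degenerate rational triangles such that $T$ has an angle equal to $\theta$, $I$ is isosceles, $T$ and $I$ have the same perimeter and the same area, and $T$ and $I$ are not congruent. Genuine pairs are counted up to homothety: $(T,I)$ and $(T',I')$ are regarded as the same pair if there is a common scaling factor $\mu>0$ such that $T'$ is congruent to $\mu T$ and $I'$ is congruent to $\mu I$; otherwise they are distinct. *)

theory Defs
  imports "HOL-Analysis.Analysis"
begin

type_synonym triangle = "(real^2) \<times> (real^2) \<times> (real^2)"

fun side_lengths :: "triangle \<Rightarrow> real \<times> real \<times> real" where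
  "side_lengths (A, B, C) = (dist B C, dist C A, dist A B)"

fun vertices :: "triangle \<Rightarrow> (real^2) set" where
  "vertices (A, B, C) = {A, B, C}"

definition nondegenerate :: "triangle \<Rightarrow> bool" where
  "nondegenerate T \<longleftrightarrow> \<not> collinear (vertices T)"

definition rational_triangle :: "triangle \<Rightarrow> bool" where
  "rational_triangle T \<longleftrightarrow> (case side_lengths T of (a, b, c) \<Rightarrow> a \<in> \<rat> \<and> b \<in> \<rat> \<and> c \<in> \<rat>)"

definition isosceles :: "triangle \<Rightarrow> bool" where
  "isosceles T \<longleftrightarrow> (case side_lengths T of (a, b, c) \<Rightarrow> a = b \<or> b = c \<or> c = a)"

definition perimeter :: "triangle \<Rightarrow> real" where
  "perimeter T = (case side_lengths T of (a, b, c) \<Rightarrow> a + b + c)"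

definition area :: "triangle \<Rightarrow> real" where
  "area T = measure lborel (convex hull (vertices T))"

text \<open>The angle at \<open>Q\<close> between the rays towards \<open>P\<close> and \<open>R\<close> (for \<open>P \<noteq> Q\<close>, \<open>R \<noteq> Q\<close>).\<close>

definition angle :: "real^2 \<Rightarrow> real^2 \<Rightarrow> real^2 \<Rightarrow> real" where
  "angle P Q R = arccos (((P - Q) \<bullet> (R - Q)) / (norm (P - Q) * norm (R - Q)))"

fun angles :: "triangle \<Rightarrow> real set" where
  "angles (A, B, C) = {angle B A C, angle C B A, angle A C B}"

text \<open>Congruence is by a not necessarily orientation-preserving isometry of the plane, and
  ignores the order in which the vertices are listed.\<close>

definition congruent_triangles :: "triangle \<Rightarrow> triangle \<Rightarrow> bool" where
  "congruent_triangles T T' \<longleftrightarrow>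
     (\<exists>f :: real^2 \<Rightarrow> real^2. (\<forall>x y. dist (f x) (f y) = dist x y) \<and> f ` vertices T = vertices T')"

fun scale_triangle :: "real \<Rightarrow> triangle \<Rightarrow> triangle" where
  "scale_triangle \<mu> (A, B, C) = (\<mu> *\<^sub>R A, \<mu> *\<^sub>R B, \<mu> *\<^sub>R C)"

text \<open>For \<open>-1 < \<rho> < 1\<close>, \<open>arccos \<rho>\<close> is the unique angle in \<open>(0, pi)\<close> with cosine \<open>\<rho>\<close>.\<close>

fun genuine_pair :: "real \<Rightarrow> triangle \<times> triangle \<Rightarrow> bool" where
  "genuine_pair \<rho> (T, I) \<longleftrightarrow>
     rational_triangle T \<and> nondegenerate T \<and> rational_triangle I \<and> nondegenerate I \<and>
     arccos \<rho> \<in> angles T \<and> isosceles I \<and>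
     perimeter T = perimeter I \<and> area T = area I \<and> \<not> congruent_triangles T I"

fun same_pair :: "triangle \<times> triangle \<Rightarrow> triangle \<times> triangle \<Rightarrow> bool" where
  "same_pair (T, I) (T', I') \<longleftrightarrow>
     (\<exists>\<mu>>0. congruent_triangles T' (scale_triangle \<mu> T) \<and>
            congruent_triangles I' (scale_triangle \<mu> I))"

definition four_distinct_genuine_pairs :: "real \<Rightarrow> (triangle \<times> triangle) set \<Rightarrow> bool" where
  "four_distinct_genuine_pairs \<rho> P \<longleftrightarrow>
     card P = 4 \<and> (\<forall>p\<in>P. genuine_pair \<rho> p) \<and> pairwise (\<lambda>p q. \<not> same_pair p q) P"

definition alpha_par :: "real \<Rightarrow> real" where
  "alpha_par l = 4 * l / (l\<^sup>2 + 3)"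

definition beta_par :: "real \<Rightarrow> real" where
  "beta_par l = (1 - l) * (l + 3) / (l\<^sup>2 + 3)"

definition r_par :: "real \<Rightarrow> real" where
  "r_par l = 6 * l * (1 - l\<^sup>2) * (9 - l\<^sup>2) / (l\<^sup>2 + 3) ^ 3"

definition delta_par :: "real \<Rightarrow> real" where
  "delta_par l = (3 - l\<^sup>2) * (3 + 6 * l - l\<^sup>2) * (3 - 6 * l - l\<^sup>2) / (l\<^sup>2 + 3) ^ 3"

definition z_plus :: "real \<Rightarrow> real" where
  "z_plus l = r_par l + delta_par l"

definition z_minus :: "real \<Rightarrow> real" where
  "z_minus l = r_par l - delta_par l"

definition rho4 :: "real \<Rightarrow> real" where
  "rho4 l = (1 - (r_par l)\<^sup>2) / (1 + (r_par l)\<^sup>2)"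

definition T0_sides :: "real \<Rightarrow> real \<times> real \<times> real" where
  "T0_sides l = (2 - 4 * (r_par l)\<^sup>2, 2 * (r_par l)\<^sup>2 + delta_par l, 2 * (r_par l)\<^sup>2 - delta_par l)"

definition T1_sides :: "real \<Rightarrow> real \<times> real \<times> real" where
  "T1_sides l = (2 / 3, (2 + delta_par l) / 3, (2 - delta_par l) / 3)"

definition I_sides :: "real \<Rightarrow> real \<times> real \<times> real" where
  "I_sides z = (1 - z\<^sup>2, (1 + z\<^sup>2) / 2, (1 + z\<^sup>2) / 2)"

end

theory Submission
  imports Defs
begin

text \<open>
  All six triangles have perimeter 2, so a scaling that matches two of the pairs is an isometry, and
  everything is decided by side lengths: Heron's formula gives the area, the law of cosines the
  angle, and a congruence permutes the sides.

  By Heron's formula, \<open>I(z)\<close> has area \<open>z (1 - z\<^sup>2) / 2\<close>. Two distinct \<open>z\<close>, \<open>w\<close> in \<open>(0, 1)\<close>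
  therefore give the same area exactly if they lie on the conic \<open>z\<^sup>2 + z w + w\<^sup>2 = 1\<close>, and there
  \<open>1 - z\<^sup>2 = w (z + w)\<close>, so that the common area is \<open>z w (z + w) / 2\<close> (\<open>heron_isosceles_conic\<close>).
  The pair \<open>(\<alpha>, \<beta>)\<close> is a rational parametrisation of this conic (\<open>conic_alpha_beta\<close>). Its
  invariant \<open>\<alpha> \<beta> (\<alpha> + \<beta>)\<close> equals \<open>2 r / 3\<close> (\<open>alpha_beta_r\<close>), the cubic \<open>z (1 - z\<^sup>2) = 2 r / 3\<close> has
  its three roots \<open>\<alpha>\<close>, \<open>\<beta>\<close>, \<open>- \<alpha> - \<beta>\<close> rational, and \<open>\<delta>\<close> is, up to a constant factor, the
  product of the differences of these roots. The discriminant relation is \<open>3 r\<^sup>2 + \<delta>\<^sup>2 = 1\<close>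
  (\<open>r_delta_relation\<close>), which says that \<open>(r - \<delta>, r + \<delta>)\<close> is again a point of the conic.

  On the other side, a triangle of semiperimeter 1 with a side \<open>a\<close> opposite the angle \<open>\<theta>\<close> has area
  \<open>(1 - a) tan (\<theta> / 2)\<close>. Here \<open>tan (\<theta> / 2) = r\<close>, so \<open>T\<^sub>1\<close> with \<open>a = 2 / 3\<close> has area \<open>r / 3\<close>,
  the area of \<open>I(\<alpha>)\<close> and \<open>I(\<beta>)\<close>, while \<open>T\<^sub>0\<close> with \<open>a = 2 - 4 r\<^sup>2\<close> has area \<open>r (4 r\<^sup>2 - 1)\<close>, the
  area of \<open>I(r - \<delta>)\<close> and \<open>I(r + \<delta>)\<close> (\<open>genuine_pair_T0\<close>, \<open>genuine_pair_T1\<close>).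

  The interval for \<open>\<lambda>\<close> serves to make \<open>3 / 7 \<le> \<alpha> \<le> 7 / 13\<close>, and \<open>z (1 - z\<^sup>2)\<close> is increasing up
  to \<open>1 / \<surd>3 > 7 / 13\<close>. This yields \<open>\<alpha> < \<beta>\<close> and \<open>r > 1 / 2\<close>, hence \<open>\<delta> < 1 / 2\<close>, and it makes \<open>\<rho>\<^sub>4\<close>
  injective, so that the infinitely many admissible \<open>\<lambda>\<close> give infinitely many \<open>\<rho>\<close>. Moreover the
  factors of \<open>\<delta>\<close> are positive on that interval. From \<open>3 r\<^sup>2 + \<delta>\<^sup>2 = 1\<close> and \<open>0 < \<delta> < 1 / 2\<close>
  follow the strict triangle inequalities for \<open>T\<^sub>0\<close> and \<open>T\<^sub>1\<close>, the fact that neither \<open>T\<^sub>0\<close> nor \<open>T\<^sub>1\<close> is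
  isosceles, and the fact that they are not congruent.
\<close>

section \<open>Triangles and their side lengths\<close>

lemma triangle_with_sides_exists:
  fixes a b c :: real
  assumes "0 < a" "a < b + c" "b < c + a" "c < a + b"
  shows "\<exists>T. side_lengths T = (a, b, c)"
proof -
  \<comment> \<open>The side \<open>a\<close> is put on the first axis, from the origin; \<open>(x, y)\<close> is the opposite vertex.\<close>
  define x where "x = (a\<^sup>2 + c\<^sup>2 - b\<^sup>2) / (2 * a)"
  define y where "y = sqrt (c\<^sup>2 - x\<^sup>2)"
  have "c\<^sup>2 - x\<^sup>2 = (a + b + c) * (b + c - a) * (c + a - b) * (a + b - c) / (2 * a)\<^sup>2"
    using assms unfolding x_def by (simp add: field_simps) algebra
  also have "\<dots> \<ge> 0"
    using assms by (intro divide_nonneg_nonneg mult_nonneg_nonneg) auto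
  finally have y: "y\<^sup>2 = c\<^sup>2 - x\<^sup>2"
    unfolding y_def by simp
  have "2 * a * x = a\<^sup>2 + c\<^sup>2 - b\<^sup>2"
    using assms by (simp add: x_def)
  then have b: "(a - x)\<^sup>2 + y\<^sup>2 = b\<^sup>2"
    unfolding y by (simp add: power2_eq_square algebra_simps)
  have dist_eq: "dist P Q = sqrt ((P $ 1 - Q $ 1)\<^sup>2 + (P $ 2 - Q $ 2)\<^sup>2)" for P Q :: "real^2"
    by (simp add: dist_vec_def L2_set_def sum_2 dist_real_def)
  have "side_lengths (vector [x, y], vector [0, 0], vector [a, 0]) = (a, b, c)"
    using assms b y by (simp add: dist_eq)
  then show ?thesis by blast
qed

lemma nondegenerate_if_triangle_inequalities:
  assumes "side_lengths T = (a, b, c)" "a < b + c" "b < c + a" "c < a + b"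
  shows "nondegenerate T"
  using assms by (cases T) (auto simp: nondegenerate_def collinear_between_cases between dist_commute)

lemma area_eq_heron:
  assumes "side_lengths T = (a, b, c)" "a + b + c = 2"
  shows "area T = sqrt ((1 - a) * (1 - b) * (1 - c))"
proof -
  obtain A B C where T: "T = (A, B, C)" by (cases T)
  show ?thesis
    using assms heron[of A B C] by (simp add: T area_def dist_commute)
qed

lemma arccos_law_of_cosines_in_angles:
  assumes "side_lengths T = (a, b, c)"
  shows "arccos ((b\<^sup>2 + c\<^sup>2 - a\<^sup>2) / (2 * b * c)) \<in> angles T"
proof -
  obtain A B C where T: "T = (A, B, C)" by (cases T)
  have abc: "a = norm (B - C)" "b = norm (C - A)" "c = norm (B - A)"
    using assms by (auto simp: T dist_norm norm_minus_commute)
  have "(B - A) \<bullet> (C - A) = (b\<^sup>2 + c\<^sup>2 - a\<^sup>2) / 2"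
    unfolding abc dot_norm_neg[of "B - A" "C - A"] by simp
  then have "angle B A C = arccos ((b\<^sup>2 + c\<^sup>2 - a\<^sup>2) / (2 * b * c))"
    by (simp only: angle_def abc) (simp add: mult.assoc mult.commute[of "norm (B - A)"])
  then show ?thesis by (simp add: T)
qed

section \<open>Congruence and scaling\<close>

text \<open>Congruence ignores the order of the vertices, so what it preserves is the multiset of sides.\<close>

definition sides_mset :: "triangle \<Rightarrow> real multiset" where
  "sides_mset T = (case side_lengths T of (a, b, c) \<Rightarrow> {#a, b, c#})"

lemma sides_mset_eq:
  "side_lengths T = (a, b, c) \<Longrightarrow> sides_mset T = {#a, b, c#}"
  by (simp add: sides_mset_def)

text \<open>
  The isometry maps the set of vertices of one triangle onto that of the other. As the vertices
  of a nondegenerate triangle are distinct, it permutes them, and with them the sides.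
\<close>

lemma sides_mset_eq_if_congruent:
  assumes "congruent_triangles T T'" "nondegenerate T"
  shows "sides_mset T = sides_mset T'"
proof -
  obtain A B C where T: "T = (A, B, C)" by (cases T)
  obtain A' B' C' where T': "T' = (A', B', C')" by (cases T')
  obtain f :: "real^2 \<Rightarrow> real^2" where iso: "\<And>x y. dist (f x) (f y) = dist x y"
    and img: "f ` {A, B, C} = {A', B', C'}"
    using assms(1) by (auto simp: congruent_triangles_def T T')
  have "A \<noteq> B" "B \<noteq> C" "A \<noteq> C"
    using assms(2) by (auto simp: nondegenerate_def T insert_commute)
  then have neq: "f A \<noteq> f B" "f B \<noteq> f C" "f A \<noteq> f C"
    using iso by (metis dist_eq_0_iff)+
  have sides: "sides_mset T = {#dist (f B) (f C), dist (f C) (f A), dist (f A) (f B)#}"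
    by (simp add: sides_mset_def T iso)
  have perm: "(f A, f B, f C) \<in> {(A', B', C'), (A', C', B'), (B', A', C'), (B', C', A'),
      (C', A', B'), (C', B', A')}"
    using img neq by (simp add: set_eq_iff) metis
  then show ?thesis
    unfolding sides by (auto simp: sides_mset_def T' dist_commute add_mset_commute)
qed

lemma side_lengths_scale_triangle:
  assumes "0 < \<mu>" "side_lengths T = (a, b, c)"
  shows "side_lengths (scale_triangle \<mu> T) = (\<mu> * a, \<mu> * b, \<mu> * c)"
proof -
  obtain A B C where T: "T = (A, B, C)" by (cases T)
  have "dist (\<mu> *\<^sub>R P) (\<mu> *\<^sub>R Q) = \<mu> * dist P Q" for P Q :: "real^2"
    using \<open>0 < \<mu>\<close> by (simp add: dist_norm flip: scaleR_diff_right)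
  then show ?thesis using assms by (auto simp: T)
qed

lemma sides_mset_eq_if_same_pair:
  assumes same: "same_pair (T, I) (T', I')"
    and nondeg: "nondegenerate T'" "nondegenerate I'"
    and perim: "perimeter T = perimeter T'" "0 < perimeter T"
  shows "sides_mset T = sides_mset T' \<and> sides_mset I = sides_mset I'"
proof -
  obtain \<mu> where \<mu>: "0 < \<mu>" and T': "congruent_triangles T' (scale_triangle \<mu> T)"
    and I': "congruent_triangles I' (scale_triangle \<mu> I)"
    using same by auto
  have perim_eq: "perimeter X = sum_mset (sides_mset X)" for X
    by (cases "side_lengths X") (simp add: perimeter_def sides_mset_def)
  have "perimeter (scale_triangle \<mu> T) = \<mu> * perimeter T"
    using side_lengths_scale_triangle[OF \<mu>, of T]
    by (cases "side_lengths T") (auto simp: perimeter_def algebra_simps)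
  then have "\<mu> * perimeter T = perimeter T"
    using sides_mset_eq_if_congruent[OF T' nondeg(1)] perim(1) by (simp add: perim_eq)
  then have "\<mu> = 1"
    using perim(2) by simp
  moreover have "scale_triangle 1 X = X" for X
    by (cases X) simp
  ultimately show ?thesis
    using sides_mset_eq_if_congruent[OF T' nondeg(1)] sides_mset_eq_if_congruent[OF I' nondeg(2)]
    by simp
qed

text \<open>
  A scalene triangle cannot be congruent to an isosceles one. At perimeter 2, the strict triangle
  inequalities say that each side is less than 1.
\<close>

lemma genuine_pairI:
  assumes T: "side_lengths T = (a, b, c)" and I: "side_lengths I = (d, e, e)"
    and perim: "a + b + c = 2" "d + e + e = 2"
    and less: "a < 1" "b < 1" "c < 1" "d < 1" "e < 1"
    and rat: "a \<in> \<rat>" "b \<in> \<rat>" "c \<in> \<rat>" "d \<in> \<rat>" "e \<in> \<rat>"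
    and scalene: "a \<noteq> b" "b \<noteq> c" "c \<noteq> a"
    and heron: "(1 - a) * (1 - b) * (1 - c) = (1 - d) * (1 - e) * (1 - e)"
    and angle: "\<rho> = (b\<^sup>2 + c\<^sup>2 - a\<^sup>2) / (2 * b * c)"
  shows "genuine_pair \<rho> (T, I)"
proof -
  have nondeg: "nondegenerate T" "nondegenerate I"
    using nondegenerate_if_triangle_inequalities[OF T] nondegenerate_if_triangle_inequalities[OF I]
      perim less by auto
  have "{#a, b, c#} \<noteq> {#d, e, e#}"
    using scalene by (auto simp: add_eq_conv_ex)
  then have "\<not> congruent_triangles T I"
    using sides_mset_eq_if_congruent[of T I] nondeg(1) T I by (auto simp: sides_mset_eq)
  moreover have "area T = area I"
    using area_eq_heron[OF T] area_eq_heron[OF I] perim heron by simp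
  moreover have "arccos \<rho> \<in> angles T"
    unfolding angle by (rule arccos_law_of_cosines_in_angles[OF T])
  ultimately show ?thesis
    using T I perim rat nondeg
    by (simp add: rational_triangle_def isosceles_def perimeter_def)
qed

section \<open>The four pairs in terms of points on the conic\<close>

lemma conic_point_bounds:
  fixes z w :: real
  assumes "z\<^sup>2 + z * w + w\<^sup>2 = 1" "0 < z" "0 < w"
  shows "z\<^sup>2 < 1" "w\<^sup>2 < 1"
  using assms by (smt (verit) mult_pos_pos zero_less_power)+

text \<open>The Heron product of \<open>I(z)\<close> is \<open>(z (1 - z\<^sup>2) / 2)\<^sup>2\<close>, and \<open>1 - z\<^sup>2 = w (z + w)\<close> on the conic.\<close>

lemma heron_isosceles_conic:
  fixes z w :: real
  assumes "z\<^sup>2 + z * w + w\<^sup>2 = 1"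
  shows "(1 - (1 - z\<^sup>2)) * (1 - (1 + z\<^sup>2) / 2) * (1 - (1 + z\<^sup>2) / 2) = (z * w * (z + w) / 2)\<^sup>2"
proof -
  have "1 - z\<^sup>2 = w * (z + w)"
    using assms by (simp add: power2_eq_square algebra_simps)
  moreover have "(1 - (1 - z\<^sup>2)) * (1 - (1 + z\<^sup>2) / 2) * (1 - (1 + z\<^sup>2) / 2)
      = (z * (1 - z\<^sup>2) / 2)\<^sup>2"
    by (simp add: power2_eq_square field_simps)
  ultimately show ?thesis
    by (simp only: mult.assoc)
qed

lemma isosceles_sides_exist:
  assumes "0 < z" "z\<^sup>2 < 1"
  shows "\<exists>T. side_lengths T = I_sides z"
proof -
  have "1 - z\<^sup>2 < (1 + z\<^sup>2) / 2 + (1 + z\<^sup>2) / 2"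
    using assms(1) by (simp flip: add_divide_distrib)
  then show ?thesis
    unfolding I_sides_def using assms(2) by (intro triangle_with_sides_exists) simp_all
qed

lemma isosceles_sides_mset_neq:
  assumes I: "side_lengths I = I_sides z" "side_lengths I' = I_sides w"
    and z: "0 < z" "z < w"
  shows "sides_mset I \<noteq> sides_mset I'"
proof -
  have "z\<^sup>2 < w\<^sup>2"
    using z by (intro power_strict_mono) auto
  moreover have False
    if eq: "{#1 - z\<^sup>2, (1 + z\<^sup>2) / 2, (1 + z\<^sup>2) / 2#}
        = {#1 - w\<^sup>2, (1 + w\<^sup>2) / 2, (1 + w\<^sup>2) / 2#}"
  proof -
    \<comment> \<open>The legs differ in length, so each leg would have to be the base of the other triangle.\<close>
    have "(1 + z\<^sup>2) / 2 \<in># {#1 - w\<^sup>2, (1 + w\<^sup>2) / 2, (1 + w\<^sup>2) / 2#}"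
      unfolding eq[symmetric] by simp
    moreover have "(1 + w\<^sup>2) / 2 \<in># {#1 - z\<^sup>2, (1 + z\<^sup>2) / 2, (1 + z\<^sup>2) / 2#}"
      unfolding eq by simp
    ultimately have "(1 + z\<^sup>2) / 2 = 1 - w\<^sup>2" "(1 + w\<^sup>2) / 2 = 1 - z\<^sup>2"
      using \<open>z\<^sup>2 < w\<^sup>2\<close> by auto
    then show False
      using \<open>z\<^sup>2 < w\<^sup>2\<close> by (simp add: field_simps)
  qed
  ultimately show ?thesis
    unfolding I[unfolded I_sides_def, THEN sides_mset_eq] by blast
qed

text \<open>
  The numbers \<open>r\<close> and \<open>d\<close> play the roles of \<open>r\<close> and \<open>\<delta>\<close>. The first assumption puts
  \<open>(r - d, r + d)\<close> on the conic, and \<open>r > 1 / 2\<close> makes the area \<open>r (4 r\<^sup>2 - 1)\<close> of \<open>T\<^sub>0\<close> positive.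
\<close>

context
  fixes r d :: real
  assumes rd: "3 * r\<^sup>2 + d\<^sup>2 = 1" and r: "1 / 2 < r" and d: "0 < d"
begin

lemma d_less_half: "d < 1 / 2"
proof (rule power2_less_imp_less)
  have "(1 / 2)\<^sup>2 < r\<^sup>2"
    using r by (intro power_strict_mono) auto
  then show "d\<^sup>2 < (1 / 2)\<^sup>2"
    using rd by (simp add: power2_eq_square)
qed simp

text \<open>
  Substituting \<open>3 r\<^sup>2 = 1 - d\<^sup>2\<close> leaves inequalities linear in \<open>d\<close> and \<open>d\<^sup>2\<close>. Those not implied by
  \<open>0 < d < 1 / 2\<close> at once follow from \<open>(1 - d) (1 - 2 d) > 0\<close> or \<open>d (1 - 2 d) > 0\<close>.
\<close>

lemma T0_inequalities:
  shows "2 - 4 * r\<^sup>2 < 1" "2 * r\<^sup>2 + d < 1" "2 * r\<^sup>2 - d < 1" "0 < 2 - 4 * r\<^sup>2"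
    "0 < 2 * r\<^sup>2 - d" "2 - 4 * r\<^sup>2 > 2 * r\<^sup>2 - d" "2 - 4 * r\<^sup>2 < 2 * r\<^sup>2 + d"
proof -
  have "0 < (1 - d) * (1 - 2 * d)"
    using d d_less_half by (intro mult_pos_pos) auto
  then have 1: "3 * d < 1 + 2 * d\<^sup>2"
    by (simp add: power2_eq_square algebra_simps)
  have "0 < d * (1 - 2 * d)"
    using d d_less_half by (intro mult_pos_pos) auto
  then have 2: "2 * d\<^sup>2 < d"
    by (simp add: power2_eq_square algebra_simps)
  have 3: "0 < d\<^sup>2"
    using d by simp
  show "2 - 4 * r\<^sup>2 < 1" "2 * r\<^sup>2 + d < 1" "2 * r\<^sup>2 - d < 1" "0 < 2 - 4 * r\<^sup>2"
    "0 < 2 * r\<^sup>2 - d" "2 - 4 * r\<^sup>2 > 2 * r\<^sup>2 - d" "2 - 4 * r\<^sup>2 < 2 * r\<^sup>2 + d"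
    using 1 2 3 rd d d_less_half by linarith+
qed

lemma T1_T0_sides_mset_neq:
  "{#2 - 4 * r\<^sup>2, 2 * r\<^sup>2 + d, 2 * r\<^sup>2 - d#} \<noteq> {#2 / 3, (2 + d) / 3, (2 - d) / 3#}"
proof
  assume eq: "{#2 - 4 * r\<^sup>2, 2 * r\<^sup>2 + d, 2 * r\<^sup>2 - d#} = {#2 / 3, (2 + d) / 3, (2 - d) / 3#}"
  \<comment> \<open>The shortest side of \<open>T\<^sub>0\<close> is shorter than every side of \<open>T\<^sub>1\<close>.\<close>
  have "2 * r\<^sup>2 - d < (2 - d) / 3"
    using T0_inequalities(6) d by simp
  moreover have "2 * r\<^sup>2 - d \<in># {#2 / 3, (2 + d) / 3, (2 - d) / 3#}"
    unfolding eq[symmetric] by simp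
  ultimately show False
    using d by auto
qed

lemma conic_z: "(r - d)\<^sup>2 + (r - d) * (r + d) + (r + d)\<^sup>2 = 1"
  using rd by (simp add: power2_eq_square algebra_simps)

lemma genuine_pair_T0:
  assumes rat: "r \<in> \<rat>" "d \<in> \<rat>"
    and T: "side_lengths T = (2 - 4 * r\<^sup>2, 2 * r\<^sup>2 + d, 2 * r\<^sup>2 - d)"
    and I: "side_lengths I = I_sides z"
    and z: "{z, w} = {r - d, r + d}"
  shows "genuine_pair ((1 - r\<^sup>2) / (1 + r\<^sup>2)) (T, I)"
proof -
  have conic: "z\<^sup>2 + z * w + w\<^sup>2 = 1" and zw: "z * w * (z + w) = 2 * r * (4 * r\<^sup>2 - 1)"
    and pos: "0 < z" "0 < w" and "z \<in> \<rat>"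
  proof -
    consider "z = r - d" "w = r + d" | "z = r + d" "w = r - d"
      using z by (auto simp: doubleton_eq_iff)
    note cases = this
    show "z\<^sup>2 + z * w + w\<^sup>2 = 1"
      by (rule cases) (use conic_z in algebra)+
    show "z * w * (z + w) = 2 * r * (4 * r\<^sup>2 - 1)"
      by (rule cases) (use rd in algebra)+
    show "0 < z" "0 < w" "z \<in> \<rat>"
      by (rule cases; use r d d_less_half rat in auto)+
  qed
  have heron: "(1 - (2 - 4 * r\<^sup>2)) * (1 - (2 * r\<^sup>2 + d)) * (1 - (2 * r\<^sup>2 - d))
      = (z * w * (z + w) / 2)\<^sup>2"
    unfolding zw using rd by (simp add: field_simps) algebra
  have bc: "(2 * r\<^sup>2 + d) * (2 * r\<^sup>2 - d) = (4 * r\<^sup>2 - 1) * (1 + r\<^sup>2)"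
    using rd by algebra
  have num: "(2 * r\<^sup>2 + d)\<^sup>2 + (2 * r\<^sup>2 - d)\<^sup>2 - (2 - 4 * r\<^sup>2)\<^sup>2
      = 2 * (4 * r\<^sup>2 - 1) * (1 - r\<^sup>2)"
    using rd by algebra
  have nz: "4 * r\<^sup>2 - 1 \<noteq> 0"
    using T0_inequalities by simp
  have "((2 * r\<^sup>2 + d)\<^sup>2 + (2 * r\<^sup>2 - d)\<^sup>2 - (2 - 4 * r\<^sup>2)\<^sup>2) / (2 * (2 * r\<^sup>2 + d) * (2 * r\<^sup>2 - d))
      = (2 * (4 * r\<^sup>2 - 1) * (1 - r\<^sup>2)) / (2 * ((4 * r\<^sup>2 - 1) * (1 + r\<^sup>2)))"
    unfolding num mult.assoc bc ..
  also have "\<dots> = (1 - r\<^sup>2) / (1 + r\<^sup>2)"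
  proof -
    have "2 * k * x / (2 * (k * y)) = x / y" if "k \<noteq> 0" for k x y :: real
      using that by simp
    then show ?thesis
      using nz .
  qed
  finally have angle: "(1 - r\<^sup>2) / (1 + r\<^sup>2) = ((2 * r\<^sup>2 + d)\<^sup>2 + (2 * r\<^sup>2 - d)\<^sup>2 - (2 - 4 * r\<^sup>2)\<^sup>2)
      / (2 * (2 * r\<^sup>2 + d) * (2 * r\<^sup>2 - d))" ..
  show ?thesis
    using T0_inequalities conic_point_bounds[OF conic pos] pos d rat \<open>z \<in> \<rat>\<close>
    by (intro genuine_pairI[OF T I[unfolded I_sides_def] _ _ _ _ _ _ _ _ _ _ _ _ _ _ _
          heron[folded heron_isosceles_conic[OF conic]] angle]) (auto simp: field_simps)
qed

lemma genuine_pair_T1: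
  assumes rat: "d \<in> \<rat>" "z \<in> \<rat>"
    and T: "side_lengths T = (2 / 3, (2 + d) / 3, (2 - d) / 3)"
    and I: "side_lengths I = I_sides z"
    and conic: "z\<^sup>2 + z * w + w\<^sup>2 = 1" and pos: "0 < z" "0 < w"
    and zw: "z * w * (z + w) = 2 * r / 3"
  shows "genuine_pair ((1 - r\<^sup>2) / (1 + r\<^sup>2)) (T, I)"
proof -
  have heron: "(1 - 2 / 3) * (1 - (2 + d) / 3) * (1 - (2 - d) / 3) = (z * w * (z + w) / 2)\<^sup>2"
    unfolding zw using rd by (simp add: field_simps power2_eq_square)
  have d2: "d\<^sup>2 = 1 - 3 * r\<^sup>2"
    using rd by simp
  have num: "((2 + d) / 3)\<^sup>2 + ((2 - d) / 3)\<^sup>2 - (2 / 3)\<^sup>2 = 2 / 3 * (1 - r\<^sup>2)"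
    using d2 by (simp add: field_simps power2_eq_square)
  have den: "2 * ((2 + d) / 3) * ((2 - d) / 3) = 2 / 3 * (1 + r\<^sup>2)"
    using d2 by (simp add: field_simps power2_eq_square)
  have angle: "(1 - r\<^sup>2) / (1 + r\<^sup>2)
      = (((2 + d) / 3)\<^sup>2 + ((2 - d) / 3)\<^sup>2 - (2 / 3)\<^sup>2) / (2 * ((2 + d) / 3) * ((2 - d) / 3))"
    unfolding num den by (subst mult_divide_mult_cancel_left) auto
  show ?thesis
    using conic_point_bounds[OF conic pos] pos d d_less_half rat
    by (intro genuine_pairI[OF T I[unfolded I_sides_def] _ _ _ _ _ _ _ _ _ _ _ _ _ _ _
          heron[folded heron_isosceles_conic[OF conic]] angle]) (auto simp: field_simps)
qed

end

section \<open>The parametrisation\<close>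

lemma square_plus_3_pos: "0 < (l::real)\<^sup>2 + 3"
  by (simp add: add_nonneg_pos)

lemma conic_alpha_beta: "(alpha_par l)\<^sup>2 + alpha_par l * beta_par l + (beta_par l)\<^sup>2 = 1"
proof -
  have "(4 * l)\<^sup>2 + 4 * l * ((1 - l) * (l + 3)) + ((1 - l) * (l + 3))\<^sup>2 = (l\<^sup>2 + 3)\<^sup>2"
    by algebra
  moreover have "alpha_par l * (l\<^sup>2 + 3) = 4 * l" "beta_par l * (l\<^sup>2 + 3) = (1 - l) * (l + 3)"
    using square_plus_3_pos[of l] by (auto simp: alpha_par_def beta_par_def)
  ultimately have "((alpha_par l)\<^sup>2 + alpha_par l * beta_par l + (beta_par l)\<^sup>2) * (l\<^sup>2 + 3)\<^sup>2
      = 1 * (l\<^sup>2 + 3)\<^sup>2"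
    by algebra
  then show ?thesis
    using square_plus_3_pos[of l] by (metis less_irrefl mult_right_cancel power_not_zero)
qed

lemma alpha_beta_r: "alpha_par l * beta_par l * (alpha_par l + beta_par l) = 2 * r_par l / 3"
proof -
  have "alpha_par l + beta_par l = (3 - l) * (1 + l) / (l\<^sup>2 + 3)"
    unfolding alpha_par_def beta_par_def
    by (simp add: power2_eq_square algebra_simps flip: add_divide_distrib)
  then have "alpha_par l * beta_par l * (alpha_par l + beta_par l)
      = 4 * l * ((1 - l) * (l + 3)) * ((3 - l) * (1 + l)) / (l\<^sup>2 + 3) ^ 3"
    by (simp add: alpha_par_def beta_par_def power3_eq_cube)
  also have "4 * l * ((1 - l) * (l + 3)) * ((3 - l) * (1 + l)) = 4 * l * (1 - l\<^sup>2) * (9 - l\<^sup>2)"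
    by algebra
  finally show ?thesis
    by (simp add: r_par_def)
qed

lemma r_eq_alpha: "2 * r_par l / 3 = alpha_par l * (1 - (alpha_par l)\<^sup>2)"
proof -
  have "1 - (alpha_par l)\<^sup>2 = beta_par l * (alpha_par l + beta_par l)"
    using conic_alpha_beta[of l] by (simp add: power2_eq_square algebra_simps)
  then show ?thesis
    using alpha_beta_r[of l] by simp
qed

lemma r_delta_relation: "3 * (r_par l)\<^sup>2 + (delta_par l)\<^sup>2 = 1"
proof -
  define D where "D = l\<^sup>2 + 3"
  have "D > 0"
    unfolding D_def by (rule square_plus_3_pos)
  have "3 * (6 * l * (1 - l\<^sup>2) * (9 - l\<^sup>2))\<^sup>2
      + ((3 - l\<^sup>2) * (3 + 6 * l - l\<^sup>2) * (3 - 6 * l - l\<^sup>2))\<^sup>2 = (D ^ 3)\<^sup>2"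
    unfolding D_def by algebra
  then show ?thesis
    using \<open>D > 0\<close> unfolding r_par_def delta_par_def D_def[symmetric]
    by (simp add: power_divide flip: add_divide_distrib)
qed

lemma par_in_Rats:
  assumes "l \<in> \<rat>"
  shows "alpha_par l \<in> \<rat>" "beta_par l \<in> \<rat>" "r_par l \<in> \<rat>" "delta_par l \<in> \<rat>" "rho4 l \<in> \<rat>"
  using assms unfolding rho4_def alpha_par_def beta_par_def r_par_def delta_par_def
  by (auto intro!: Rats_divide Rats_mult Rats_diff Rats_add Rats_power)

lemma alpha_bounds:
  assumes "1 / 3 \<le> l" "l \<le> 3 / 7"
  shows "3 / 7 \<le> alpha_par l" "alpha_par l \<le> 7 / 13"
proof -
  \<comment> \<open>The quadratics in \<open>l\<close> that \<open>\<alpha> = 3 / 7\<close> and \<open>\<alpha> = 7 / 13\<close> amount to split over the rationals.\<close>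
  have "0 \<le> (3 * l - 1) * (9 - l)" "0 \<le> (3 - 7 * l) * (7 - l)"
    using assms by (auto intro!: mult_nonneg_nonneg)
  then have "3 / 7 * (l\<^sup>2 + 3) \<le> 4 * l" "4 * l \<le> 7 / 13 * (l\<^sup>2 + 3)"
    by (auto simp: power2_eq_square algebra_simps)
  then show "3 / 7 \<le> alpha_par l" "alpha_par l \<le> 7 / 13"
    unfolding alpha_par_def pos_le_divide_eq[OF square_plus_3_pos]
      pos_divide_le_eq[OF square_plus_3_pos] by blast+
qed

text \<open>
  The difference of the values of \<open>z (1 - z\<^sup>2)\<close> at \<open>x\<close> and \<open>y\<close> is \<open>y - x\<close> times this factor, whose
  positivity below \<open>7 / 13 < 1 / \<surd>3\<close> makes that cubic increasing there.
\<close>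

lemma conic_form_less_1:
  fixes x y :: real
  assumes "0 \<le> x" "x \<le> 7 / 13" "0 \<le> y" "y \<le> 7 / 13"
  shows "0 < 1 - x\<^sup>2 - x * y - y\<^sup>2"
proof -
  have "x * x \<le> 7 / 13 * (7 / 13)" "x * y \<le> 7 / 13 * (7 / 13)" "y * y \<le> 7 / 13 * (7 / 13)"
    using assms by (intro mult_mono; simp)+
  then show ?thesis by (simp add: power2_eq_square)
qed

lemma alpha_less_beta:
  assumes "1 / 3 \<le> l" "l \<le> 3 / 7"
  shows "0 < alpha_par l" "alpha_par l < beta_par l"
proof -
  show "0 < alpha_par l"
    using alpha_bounds[OF assms] by simp
  have "0 < beta_par l"
    unfolding beta_par_def using assms square_plus_3_pos[of l]
    by (intro divide_pos_pos mult_pos_pos) auto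
  then show "alpha_par l < beta_par l"
    using conic_form_less_1[of "alpha_par l" "beta_par l"] alpha_bounds[OF assms]
      conic_alpha_beta[of l] by force
qed

lemma r_greater_half:
  assumes "1 / 3 \<le> l" "l \<le> 3 / 7"
  shows "1 / 2 < r_par l"
proof -
  define a where "a = alpha_par l"
  note a = alpha_bounds[OF assms, folded a_def]
  have "0 \<le> (a - 3 / 7) * (1 - a\<^sup>2 - a * (3 / 7) - (3 / 7)\<^sup>2)"
    using a conic_form_less_1[of a "3 / 7"] by (intro mult_nonneg_nonneg) auto
  \<comment> \<open>The value of \<open>z (1 - z\<^sup>2)\<close> at \<open>3 / 7\<close> is \<open>120 / 343\<close>, just above \<open>1 / 3\<close>.\<close>
  also have "\<dots> = a * (1 - a\<^sup>2) - 120 / 343"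
    by (simp add: power2_eq_square field_simps)
  finally show ?thesis
    using r_eq_alpha[of l] by (simp add: a_def)
qed

lemma delta_pos:
  assumes "1 / 3 \<le> l" "l \<le> 3 / 7"
  shows "0 < delta_par l"
proof -
  have "l * l \<le> 3 / 7 * (3 / 7)"
    using assms by (intro mult_mono) auto
  then show ?thesis
    unfolding delta_par_def using assms square_plus_3_pos[of l]
    by (intro divide_pos_pos mult_pos_pos zero_less_power) (auto simp: power2_eq_square)
qed

lemma inj_on_rho4: "inj_on rho4 {1 / 3..3 / 7}"
proof (rule inj_onI)
  fix l m
  assume "l \<in> {1 / 3..3 / 7}" "m \<in> {1 / 3..3 / 7}" and eq: "rho4 l = rho4 m"
  then have l: "1 / 3 \<le> l" "l \<le> 3 / 7" and m: "1 / 3 \<le> m" "m \<le> 3 / 7"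
    by auto
  have "1 + (r_par x)\<^sup>2 \<noteq> 0" for x
    by (simp add: add_nonneg_eq_0_iff)
  then have "(r_par l)\<^sup>2 = (r_par m)\<^sup>2"
    using eq unfolding rho4_def by (simp add: frac_eq_eq algebra_simps)
  then have "r_par l = r_par m"
    using r_greater_half[OF l] r_greater_half[OF m] by (simp add: power2_eq_iff_nonneg)
  then have "alpha_par l * (1 - (alpha_par l)\<^sup>2) = alpha_par m * (1 - (alpha_par m)\<^sup>2)"
    by (simp flip: r_eq_alpha)
  then have "(alpha_par l - alpha_par m)
      * (1 - (alpha_par l)\<^sup>2 - alpha_par l * alpha_par m - (alpha_par m)\<^sup>2) = 0"
    by algebra
  then have "alpha_par l = alpha_par m"
    using conic_form_less_1[of "alpha_par l" "alpha_par m"] alpha_bounds[OF l] alpha_bounds[OF m]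
    by simp
  then have "4 * l * (m\<^sup>2 + 3) = 4 * m * (l\<^sup>2 + 3)"
    using square_plus_3_pos[of l] square_plus_3_pos[of m]
    by (simp add: alpha_par_def frac_eq_eq)
  then have "(l - m) * (3 - l * m) = 0"
    by algebra
  moreover have "l * m \<le> 3 / 7 * (3 / 7)"
    using l m by (intro mult_mono) auto
  ultimately show "l = m"
    by simp
qed

lemma infinite_rationals_in_interval: "infinite {l::real. l \<in> \<rat> \<and> 1 / 3 \<le> l \<and> l \<le> 3 / 7}"
proof
  \<comment> \<open>The offset 11 keeps the values in the interval, because \<open>1 / 11 < 3 / 7 - 1 / 3 = 2 / 21\<close>.\<close>
  let ?f = "\<lambda>n::nat. 1 / 3 + 1 / (real n + 11)"
  assume "finite {l::real. l \<in> \<rat> \<and> 1 / 3 \<le> l \<and> l \<le> 3 / 7}"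
  moreover have "range ?f \<subseteq> {l::real. l \<in> \<rat> \<and> 1 / 3 \<le> l \<and> l \<le> 3 / 7}"
    by (auto simp: field_simps)
  ultimately have "finite (range ?f)"
    by (rule finite_subset[rotated])
  moreover have "inj ?f"
    by (auto simp: inj_def)
  ultimately show False
    using finite_imageD infinite_UNIV_nat by blast
qed

section \<open>Four genuine pairs for infinitely many angles\<close>

lemma sides_exist:
  assumes l: "1 / 3 \<le> l" "l \<le> 3 / 7"
    and s: "s \<in> {T0_sides l, T1_sides l, I_sides (z_minus l), I_sides (z_plus l),
      I_sides (alpha_par l), I_sides (beta_par l)}"
  shows "\<exists>T. side_lengths T = s"
proof -
  note rd = r_delta_relation[of l] r_greater_half[OF l] delta_pos[OF l]
  have d: "delta_par l < 1 / 2"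
    using d_less_half[OF rd] .
  have "\<exists>T. side_lengths T = T0_sides l"
    unfolding T0_sides_def using T0_inequalities[OF rd]
    by (intro triangle_with_sides_exists) linarith+
  moreover have "\<exists>T. side_lengths T = T1_sides l"
    unfolding T1_sides_def using d rd(3)
    by (intro triangle_with_sides_exists) (auto simp: field_simps)
  moreover have "\<exists>T. side_lengths T = I_sides (z_minus l)" "\<exists>T. side_lengths T = I_sides (z_plus l)"
    using conic_point_bounds[OF conic_z[OF rd]] d rd(2,3)
    unfolding z_minus_def z_plus_def by (auto simp del: split_paired_Ex intro!: isosceles_sides_exist)
  moreover have "\<exists>T. side_lengths T = I_sides (alpha_par l)"
    "\<exists>T. side_lengths T = I_sides (beta_par l)"
    using conic_point_bounds[OF conic_alpha_beta[of l]] alpha_less_beta[OF l]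
    by (auto simp del: split_paired_Ex intro!: isosceles_sides_exist)
  ultimately show ?thesis
    using s by auto
qed

text \<open>
  The two pairs that share \<open>T\<^sub>0\<close>, or share \<open>T\<^sub>1\<close>, differ in the isosceles triangle, and a pair with
  \<open>T\<^sub>0\<close> differs from one with \<open>T\<^sub>1\<close> in the first triangle.
\<close>

lemma four_pairs_at:
  fixes T0 T1 Im Ip Ia Ib :: triangle
  assumes l: "l \<in> \<rat>" "1 / 3 \<le> l" "l \<le> 3 / 7"
    and T0: "side_lengths T0 = T0_sides l" and T1: "side_lengths T1 = T1_sides l"
    and Im: "side_lengths Im = I_sides (z_minus l)" and Ip: "side_lengths Ip = I_sides (z_plus l)"
    and Ia: "side_lengths Ia = I_sides (alpha_par l)"
    and Ib: "side_lengths Ib = I_sides (beta_par l)"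
  shows "four_distinct_genuine_pairs (rho4 l) {(T0, Im), (T0, Ip), (T1, Ia), (T1, Ib)}"
    (is "four_distinct_genuine_pairs _ ?P")
proof -
  note rd = r_delta_relation[of l] r_greater_half[OF l(2,3)] delta_pos[OF l(2,3)]
  note rat = par_in_Rats[OF l(1)]
  note ab = alpha_less_beta[OF l(2,3)]
  have b: "0 < beta_par l"
    using ab by simp
  have conic_ba: "(beta_par l)\<^sup>2 + beta_par l * alpha_par l + (alpha_par l)\<^sup>2 = 1"
    using conic_alpha_beta[of l] by (simp add: algebra_simps)
  have ba_r: "beta_par l * alpha_par l * (beta_par l + alpha_par l) = 2 * r_par l / 3"
    using alpha_beta_r[of l] by (simp add: algebra_simps)
  have "genuine_pair (rho4 l) (T0, Im)" "genuine_pair (rho4 l) (T0, Ip)"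
    unfolding rho4_def
    using genuine_pair_T0[OF rd rat(3,4) T0[unfolded T0_sides_def] Im, of "z_plus l"]
      genuine_pair_T0[OF rd rat(3,4) T0[unfolded T0_sides_def] Ip, of "z_minus l"]
    by (auto simp: z_minus_def z_plus_def)
  moreover have "genuine_pair (rho4 l) (T1, Ia)" "genuine_pair (rho4 l) (T1, Ib)"
    unfolding rho4_def
    using genuine_pair_T1[OF rd rat(4,1) T1[unfolded T1_sides_def] Ia conic_alpha_beta
        ab(1) b alpha_beta_r]
      genuine_pair_T1[OF rd rat(4,2) T1[unfolded T1_sides_def] Ib conic_ba b ab(1) ba_r]
    by auto
  ultimately have genuine: "\<forall>p\<in>?P. genuine_pair (rho4 l) p"
    by simp
  have T_neq: "sides_mset T0 \<noteq> sides_mset T1"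
    using T1_T0_sides_mset_neq[OF rd]
    unfolding T0[unfolded T0_sides_def, THEN sides_mset_eq]
      T1[unfolded T1_sides_def, THEN sides_mset_eq] .
  have I_neq: "sides_mset Im \<noteq> sides_mset Ip" "sides_mset Ia \<noteq> sides_mset Ib"
    using isosceles_sides_mset_neq[OF Im Ip] isosceles_sides_mset_neq[OF Ia Ib] ab rd(2,3)
      d_less_half[OF rd] by (auto simp: z_minus_def z_plus_def)
  have perim: "perimeter (fst p) = 2" if "p \<in> ?P" for p
    using that T0 T1 by (auto simp: perimeter_def T0_sides_def T1_sides_def field_simps)
  have nondeg: "nondegenerate (fst p)" "nondegenerate (snd p)" if "p \<in> ?P" for p
    using that genuine by auto
  have same: "sides_mset (fst p) = sides_mset (fst q) \<and> sides_mset (snd p) = sides_mset (snd q)"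
    if "same_pair p q" "p \<in> ?P" "q \<in> ?P" for p q
    using that nondeg[OF that(3)] perim[OF that(2)] perim[OF that(3)]
    by (intro sides_mset_eq_if_same_pair) simp_all
  have "card ?P = 4"
    using T_neq I_neq by (auto simp: card_insert_if)
  moreover have "pairwise (\<lambda>p q. \<not> same_pair p q) ?P"
    unfolding pairwise_def
  proof (intro ballI impI notI)
    fix p q
    assume pq: "p \<in> ?P" "q \<in> ?P" "p \<noteq> q" "same_pair p q"
    show False
      using same[OF pq(4,1,2)] pq(1-3) T_neq I_neq by auto
  qed
  ultimately show ?thesis
    using genuine unfolding four_distinct_genuine_pairs_def by blast
qed

lemma rho4_bounds:
  assumes "1 / 3 \<le> l" "l \<le> 3 / 7"
  shows "-1 < rho4 l" "rho4 l < 1"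
proof -
  have "0 < (r_par l)\<^sup>2"
    using r_greater_half[OF assms] by simp
  then show "-1 < rho4 l" "rho4 l < 1"
    unfolding rho4_def by (simp_all add: pos_less_divide_eq pos_divide_less_eq add_pos_pos)
qed

theorem theorem9p1:
  shows "(\<forall>l::real. l \<in> \<rat> \<and> 1/3 \<le> l \<and> l \<le> 3/7 \<longrightarrow>
            rho4 l \<in> \<rat> \<and> -1 < rho4 l \<and> rho4 l < 1 \<and>
            (\<forall>s \<in> {T0_sides l, T1_sides l, I_sides (z_minus l), I_sides (z_plus l),
                     I_sides (alpha_par l), I_sides (beta_par l)}.
               \<exists>T. side_lengths T = s) \<and>
            (\<forall>T0 T1 Im Ip Ia Ib.
               side_lengths T0 = T0_sides l \<and> side_lengths T1 = T1_sides l \<and>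
               side_lengths Im = I_sides (z_minus l) \<and> side_lengths Ip = I_sides (z_plus l) \<and>
               side_lengths Ia = I_sides (alpha_par l) \<and> side_lengths Ib = I_sides (beta_par l) \<longrightarrow>
               four_distinct_genuine_pairs (rho4 l) {(T0, Im), (T0, Ip), (T1, Ia), (T1, Ib)}))
       \<and> infinite {\<rho>::real. \<rho> \<in> \<rat> \<and> -1 < \<rho> \<and> \<rho> < 1 \<and>
                       (\<exists>P. four_distinct_genuine_pairs \<rho> P)}"
proof (intro conjI allI impI ballI)
  fix l :: real
  assume l: "l \<in> \<rat> \<and> 1/3 \<le> l \<and> l \<le> 3/7"
  then show "rho4 l \<in> \<rat>" "-1 < rho4 l" "rho4 l < 1"
    using par_in_Rats(5) rho4_bounds by simp_all
  show "\<exists>T. side_lengths T = s"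
    if "s \<in> {T0_sides l, T1_sides l, I_sides (z_minus l), I_sides (z_plus l),
                     I_sides (alpha_par l), I_sides (beta_par l)}" for s
    by (rule sides_exist[OF _ _ that]) (use l in simp_all)
  show "four_distinct_genuine_pairs (rho4 l) {(T0, Im), (T0, Ip), (T1, Ia), (T1, Ib)}"
    if "side_lengths T0 = T0_sides l \<and> side_lengths T1 = T1_sides l \<and>
               side_lengths Im = I_sides (z_minus l) \<and> side_lengths Ip = I_sides (z_plus l) \<and>
               side_lengths Ia = I_sides (alpha_par l) \<and> side_lengths Ib = I_sides (beta_par l)"
    for T0 T1 Im Ip Ia Ib
    using l that by (elim conjE) (rule four_pairs_at)
next
  let ?L = "{l::real. l \<in> \<rat> \<and> 1 / 3 \<le> l \<and> l \<le> 3 / 7}"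
  let ?R = "{\<rho>::real. \<rho> \<in> \<rat> \<and> -1 < \<rho> \<and> \<rho> < 1 \<and> (\<exists>P. four_distinct_genuine_pairs \<rho> P)}"
  have "rho4 ` ?L \<subseteq> ?R"
  proof clarify
    fix l :: real
    assume l: "l \<in> \<rat>" "1 / 3 \<le> l" "l \<le> 3 / 7"
    note ex = sides_exist[OF l(2,3)]
    obtain T0 where T0: "side_lengths T0 = T0_sides l"
      using ex[of "T0_sides l"] by blast
    obtain T1 where T1: "side_lengths T1 = T1_sides l"
      using ex[of "T1_sides l"] by blast
    obtain Im Ip where Im: "side_lengths Im = I_sides (z_minus l)"
      and Ip: "side_lengths Ip = I_sides (z_plus l)"
      using ex[of "I_sides (z_minus l)"] ex[of "I_sides (z_plus l)"] by blast
    obtain Ia Ib where Ia: "side_lengths Ia = I_sides (alpha_par l)"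
      and Ib: "side_lengths Ib = I_sides (beta_par l)"
      using ex[of "I_sides (alpha_par l)"] ex[of "I_sides (beta_par l)"] by blast
    note four_pairs = four_pairs_at[OF l T0 T1 Im Ip Ia Ib]
    show "rho4 l \<in> \<rat> \<and> -1 < rho4 l \<and> rho4 l < 1
        \<and> (\<exists>P. four_distinct_genuine_pairs (rho4 l) P)"
      using par_in_Rats(5)[OF l(1)] rho4_bounds[OF l(2,3)] four_pairs by blast
  qed
  moreover have "infinite (rho4 ` ?L)"
  proof -
    have "inj_on rho4 ?L"
      by (rule inj_on_subset[OF inj_on_rho4]) auto
    then show ?thesis
      using infinite_rationals_in_interval finite_imageD by blast
  qed
  ultimately show "infinite ?R"
    by (rule infinite_super)
qed

end
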